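(* For all $\eta,\gamma\in\mathbb{C}$, the function $\Omega_{\eta,\gamma}:\mathbb{C}\to\mathbb{C}$ defined by \[\Omega_{\eta,\gamma}(n)=\eta\cdot(-1)^{n-1}\cdot\Theta(n)+\gamma\cdot(-1)^{n}\cdot\Theta(n-1)\cdot\phi,\qquad n\in\mathbb{C},\] is a complex complete nFe-sequence, i.e. $\Omega_{\eta,\gamma}(n)=\Omega_{\eta,\gamma}(n-2)-\Omega_{\eta,\gamma}(n-1)$ for all $n\in\mathbb{C}$.
   Context: $\phi=\frac{1+\sqrt5}{2}$. For complex $n$, $(-1)^n:=\exp(i\pi n)$, $\phi^n:=\exp(n\log\phi)$ with the real logarithm of $\phi$, and $(-\phi)^n:=(-1)^n\cdot\phi^n=\exp(i\pi n)\,\phi^n$. The function $\Theta:\mathbb{C}\to\mathbb{C}$ is $\Theta(n)=\frac{\phi^n-(-\phi)^{-n}}{\sqrt5}$ (it extends the Fibonacci numbers). A function $\tilde\omega:\mathbb{C}\to\mathbb{C}$ is called a complex complete nFe-sequence (negaFibonacci-esque sequence) if $\tilde\omega(n)=\tilde\omega(n-2)-\tilde\omega(n-1)$ for all $n\in\mathbb{C}$. *)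

theory Defs
  imports Complex_Main
begin

definition golden_ratio :: real where
  "golden_ratio = (1 + sqrt 5) / 2"

text \<open>The complex powers of \<open>-1\<close>, of the golden ratio and of its negative. The branch is fixed by
  the definitions: \<open>i * pi\<close> serves as the logarithm of \<open>-1\<close>, and the logarithm of the golden
  ratio is the real one.\<close>

definition neg_one_pow :: "complex \<Rightarrow> complex" where
  "neg_one_pow n = exp (\<i> * complex_of_real pi * n)"

definition phi_pow :: "complex \<Rightarrow> complex" where
  "phi_pow n = exp (n * complex_of_real (ln golden_ratio))"

definition neg_phi_pow :: "complex \<Rightarrow> complex" where
  "neg_phi_pow n = neg_one_pow n * phi_pow n"

definition Theta :: "complex \<Rightarrow> complex" where
  "Theta n = (phi_pow n - neg_phi_pow (- n)) / complex_of_real (sqrt 5)"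

definition complex_complete_nFe :: "(complex \<Rightarrow> complex) \<Rightarrow> bool" where
  "complex_complete_nFe w \<longleftrightarrow> (\<forall>n. w n = w (n - 2) - w (n - 1))"

definition Omega :: "complex \<Rightarrow> complex \<Rightarrow> complex \<Rightarrow> complex" where
  "Omega \<eta> \<gamma> n =
     \<eta> * neg_one_pow (n - 1) * Theta n
     + \<gamma> * neg_one_pow n * Theta (n - 1) * complex_of_real golden_ratio"

end

theory Submission
  imports Defs
begin

text \<open>Both \<open>\<phi>\<close> and \<open>-1/\<phi>\<close> are roots of \<open>x\<^sup>2 = x + 1\<close>, so \<open>\<Theta>\<close> satisfies the
  Fibonacci recurrence on all of the complex plane; multiplying by \<open>(-1)\<^sup>n\<close>, which
  changes sign under a unit shift, turns it into the negaFibonacci-type recurrence.\<close>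

lemma golden_ratio_pos: "golden_ratio > 0"
  by (simp add: golden_ratio_def add_pos_nonneg)

lemma golden_ratio_square: "golden_ratio * golden_ratio = golden_ratio + 1"
  by (simp add: golden_ratio_def field_simps)

lemma neg_one_pow_plus_1: "neg_one_pow (n + 1) = - neg_one_pow n"
  by (simp add: neg_one_pow_def distrib_left exp_add)

lemma phi_pow_plus_1: "phi_pow (n + 1) = phi_pow n * complex_of_real golden_ratio"
  using golden_ratio_pos by (simp add: phi_pow_def distrib_right exp_add exp_of_real)

lemma neg_phi_pow_plus_1:
  "neg_phi_pow (n + 1) = - (neg_phi_pow n * complex_of_real golden_ratio)"
  by (simp add: neg_phi_pow_def neg_one_pow_plus_1 phi_pow_plus_1)

text \<open>The free factor \<open>x\<close> makes this a rewrite rule for the left-nested products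
  left by two unit shifts.\<close>

lemma golden_ratio_square_mult:
  "x * complex_of_real golden_ratio * complex_of_real golden_ratio
     = x * complex_of_real golden_ratio + x"
  by (metis (no_types) golden_ratio_square of_real_mult of_real_add of_real_1 mult.assoc
      distrib_left mult.right_neutral)

lemma phi_pow_plus_2: "phi_pow (n + 2) = phi_pow (n + 1) + phi_pow n"
  using phi_pow_plus_1[of "n + 1"]
  by (simp add: phi_pow_plus_1 golden_ratio_square_mult add.assoc)

text \<open>A unit shift multiplies by \<open>r = -golden_ratio\<close>, and
  \<open>r * r = 1 - r\<close>.\<close>

lemma neg_phi_pow_plus_2: "neg_phi_pow (n + 2) = neg_phi_pow n - neg_phi_pow (n + 1)"
  using neg_phi_pow_plus_1[of "n + 1"]
  by (simp add: neg_phi_pow_plus_1 golden_ratio_square_mult add.assoc)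

lemma Theta_plus_2: "Theta (n + 2) = Theta (n + 1) + Theta n"
proof -
  \<comment> \<open>With \<open>m = - (n + 2)\<close> the arguments are \<open>m\<close>,
    \<open>m + 1\<close>, \<open>m + 2\<close>; solving for the lowest term gives the Fibonacci
    form.\<close>
  have "neg_phi_pow (- (n + 2)) = neg_phi_pow (- (n + 1)) + neg_phi_pow (- n)"
    using neg_phi_pow_plus_2[of "- (n + 2)"] by (simp add: algebra_simps)
  then show ?thesis
    by (simp only: Theta_def phi_pow_plus_2 add_divide_distrib diff_divide_distrib) simp
qed

lemma neg_one_pow_minus_1: "neg_one_pow (n - 1) = - neg_one_pow n"
  using neg_one_pow_plus_1[of "n - 1"] by simp

lemma Theta_rec: "Theta n = Theta (n - 1) + Theta (n - 2)"
  using Theta_plus_2[of "n - 2"] by simp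

theorem theorem3p4:
  fixes \<eta> \<gamma> :: complex
  shows "complex_complete_nFe (Omega \<eta> \<gamma>)"
  unfolding complex_complete_nFe_def
proof
  fix n
  \<comment> \<open>\<open>n - 3\<close> comes from the first summand of \<open>Omega\<close> at
    \<open>n - 2\<close>.\<close>
  have s: "neg_one_pow (n - 2) = neg_one_pow n" "neg_one_pow (n - 3) = - neg_one_pow n"
    using neg_one_pow_minus_1[of "n - 1"] neg_one_pow_minus_1[of "n - 2"]
    by (simp_all add: neg_one_pow_minus_1)
  show "Omega \<eta> \<gamma> n = Omega \<eta> \<gamma> (n - 2) - Omega \<eta> \<gamma> (n - 1)"
    \<comment> \<open>With \<open>neg_one_pow n\<close> factored out, the \<eta> terms need the
      recurrence at \<open>n\<close>, the \<gamma> terms at \<open>n - 1\<close>.\<close>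
    using Theta_rec[of n] Theta_rec[of "n - 1"]
    by (simp add: Omega_def neg_one_pow_minus_1 s algebra_simps)
qed

end
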